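(* Let $1\le k<N$ be integers, let $\Omega\subset\mathbb R^N$ be a bounded convex domain and assume that, up to a rigid motion, there exists $\delta>0$ such that the $k$-dimensional ball $$B_{k,\delta}=\{x=(x_1,\dots,x_k,0,\dots,0)\in\mathbb R^N : |x|<\delta\}$$ is contained in $\partial\Omega$. Then there are no supersolutions $u\in \mathrm{LSC}(\overline\Omega)$ of $$\mathcal P_k^+(D^2u)=-1\ \text{ in }\Omega,\qquad u=0\ \text{ on }\partial\Omega,$$ such that $\lim_{x\to0}u(x)=0$.
   Context: For a symmetric $N\times N$ matrix $X$ with ordered eigenvalues $\lambda_1(X)\le\dots\le\lambda_N(X)$, $\mathcal P_k^+(X)=\sum_{i=1}^k\lambda_{N+1-i}(X)$. $\mathrm{LSC}(\overline\Omega)$ is the set of real-valued lower semicontinuous functions on $\overline\Omega$. A supersolution of the Dirichlet problem is a function $u\in\mathrm{LSC}(\overline\Omega)$ with $u\ge0$ on $\partial\Omega$ which satisfies $\mathcal P_k^+(D^2u)\le-1$ in $\Omega$ in the viscosity sense: whenever $\varphi$ is $C^2$ near $x_0\in\Omega$ and $u-\varphi$ has a local minimum at $x_0$, then $\mathcal P_k^+(D^2\varphi(x_0))\le-1$. The limit $x\to0$ is taken through points of $\Omega$ (the origin being the center of $B_{k,\delta}$, a boundary point of $\Omega$). *)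

theory Defs
  imports "HOL-Analysis.Analysis"
begin

text \<open>Eigenvalues are listed in increasing order, each repeated according to the dimension of its
  eigenspace. For a symmetric matrix this is the usual multiplicity, so that the list has length
  \<^term>\<open>CARD('n)\<close>; only symmetric matrices are of interest here.\<close>

definition eigenspace :: "real^'n^'n \<Rightarrow> real \<Rightarrow> (real^'n) set" where
  "eigenspace X c = {v. X *v v = c *\<^sub>R v}"

definition ordered_eigenvalues :: "real^'n^'n \<Rightarrow> real list" where
  "ordered_eigenvalues X =
     concat (map (\<lambda>c. replicate (dim (eigenspace X c)) c)
       (sorted_list_of_set {c. \<exists>v. v \<noteq> 0 \<and> X *v v = c *\<^sub>R v}))"

definition eigval :: "real^'n^'n \<Rightarrow> nat \<Rightarrow> real" where
  "eigval X i = ordered_eigenvalues X ! (i - 1)"  \<comment> \<open>indices start at 1\<close>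

definition P_plus :: "nat \<Rightarrow> real^'n^'n \<Rightarrow> real" where
  "P_plus k X = (\<Sum>i=1..k. eigval X (CARD('n) + 1 - i))"

definition gradient :: "(real^'n \<Rightarrow> real) \<Rightarrow> real^'n \<Rightarrow> real^'n" where
  "gradient \<phi> x = (\<chi> i. frechet_derivative \<phi> (at x) (axis i 1))"

definition hessian :: "(real^'n \<Rightarrow> real) \<Rightarrow> real^'n \<Rightarrow> real^'n^'n" where
  "hessian \<phi> x = matrix (frechet_derivative (gradient \<phi>) (at x))"

definition C2_near :: "(real^'n \<Rightarrow> real) \<Rightarrow> real^'n \<Rightarrow> bool" where
  "C2_near \<phi> x0 \<longleftrightarrow>
     (\<exists>U. open U \<and> x0 \<in> U \<and>
        (\<forall>x\<in>U. \<phi> differentiable (at x) \<and> gradient \<phi> differentiable (at x)) \<and>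
        continuous_on U (hessian \<phi>))"

definition local_min_at :: "(real^'n \<Rightarrow> real) \<Rightarrow> real^'n \<Rightarrow> bool" where
  "local_min_at w x0 \<longleftrightarrow> (\<forall>\<^sub>F x in nhds x0. w x0 \<le> w x)"

definition lsc_on :: "(real^'n) set \<Rightarrow> (real^'n \<Rightarrow> real) \<Rightarrow> bool" where
  "lsc_on S u \<longleftrightarrow> (\<forall>x\<in>S. \<forall>a < u x. \<forall>\<^sub>F y in at x within S. a < u y)"

text \<open>Below \<^term>\<open>\<Omega>\<close> is open, so a local minimum of \<^term>\<open>\<lambda>x. u x - \<phi> x\<close> at a point of
  \<^term>\<open>\<Omega>\<close> does not depend on the values of \<^term>\<open>u\<close> outside \<^term>\<open>\<Omega>\<close>.\<close>

definition viscosity_supersolution :: "nat \<Rightarrow> (real^'n) set \<Rightarrow> (real^'n \<Rightarrow> real) \<Rightarrow> bool" where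
  "viscosity_supersolution k \<Omega> u \<longleftrightarrow>
     (\<forall>x0\<in>\<Omega>. \<forall>\<phi>. C2_near \<phi> x0 \<and> local_min_at (\<lambda>x. u x - \<phi> x) x0
        \<longrightarrow> P_plus k (hessian \<phi> x0) \<le> -1)"

definition dirichlet_supersolution :: "nat \<Rightarrow> (real^'n) set \<Rightarrow> (real^'n \<Rightarrow> real) \<Rightarrow> bool" where
  "dirichlet_supersolution k \<Omega> u \<longleftrightarrow>
     lsc_on (closure \<Omega>) u \<and> (\<forall>x\<in>frontier \<Omega>. 0 \<le> u x) \<and> viscosity_supersolution k \<Omega> u"

definition rigid_motion :: "(real^'n \<Rightarrow> real^'n) \<Rightarrow> bool" where
  "rigid_motion T \<longleftrightarrow> (\<exists>a f. orthogonal_transformation f \<and> T = (\<lambda>x. a + f x))"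

text \<open>The finite index type carries no order, so the coordinates are numbered by a bijection
  \<^term>\<open>e\<close> from \<^term>\<open>{1..CARD('n)}\<close> onto it: the \<^term>\<open>i\<close>-th coordinate of \<^term>\<open>x\<close> is
  \<^term>\<open>x $ e i\<close>.\<close>

definition flat_ball :: "(nat \<Rightarrow> 'n) \<Rightarrow> nat \<Rightarrow> real \<Rightarrow> (real^'n) set" where
  "flat_ball e k \<delta> = {x. (\<forall>i\<in>{k+1..CARD('n)}. x $ e i = 0) \<and> norm x < \<delta>}"

end

theory Submission
  imports Defs
begin

text \<open>The operator \<open>\<P>\<^sub>k\<^sup>+\<close> dominates the trace on every \<open>k\<close>-dimensional subspace, so along a
  \<open>k\<close>-dimensional disc inside \<open>\<Omega>\<close> a supersolution lies above a fixed paraboloid that vanishes on the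
  rim of the disc; adding a sufficiently negative quadratic term in the normal directions turns that
  paraboloid into a test function on \<open>\<Omega>\<close> that is nonpositive on \<open>\<partial>\<Omega>\<close>. By convexity, the flat piece of
  the boundary can be pushed slightly towards an interior point, which gives parallel discs inside
  \<open>\<Omega>\<close>, of radius bounded below, whose centres tend to the centre of the flat piece. At these
  centres the supersolution stays above a fixed positive constant.\<close>

section \<open>Lower semicontinuity and comparison with smooth functions\<close>

lemma lsc_on_diff_continuous:
  assumes u: "lsc_on S u" and \<phi>: "continuous_on S \<phi>"
  shows "lsc_on S (\<lambda>x. u x - \<phi> x)"
  unfolding lsc_on_def
proof (intro ballI allI impI)
  fix x a assume x: "x \<in> S" and a: "a < u x - \<phi> x"
  define r where "r = (u x - \<phi> x - a) / 2"
  have "r > 0" using a by (simp add: r_def)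
  have "\<forall>\<^sub>F y in at x within S. u x - r < u y"
    using u x \<open>r > 0\<close> unfolding lsc_on_def by simp
  moreover have "\<forall>\<^sub>F y in at x within S. \<phi> y < \<phi> x + r"
    using \<phi> x \<open>r > 0\<close> order_tendstoD(2)[of \<phi> "\<phi> x" "at x within S" "\<phi> x + r"]
    by (simp add: continuous_on_def)
  ultimately show "\<forall>\<^sub>F y in at x within S. a < u y - \<phi> y"
  proof eventually_elim
    case (elim y)
    then show ?case by (simp add: r_def field_simps)
  qed
qed

text \<open>If no point were minimal, every \<open>x\<close> would be beaten by some
  \<open>h x\<close>, and by semicontinuity \<open>w\<close> would stay above \<open>w (h x)\<close>
  on a whole neighbourhood \<open>U x\<close>. Finitely many of these cover \<open>S\<close>, which
  the smallest of the finitely many values \<open>w (h x)\<close> contradicts.\<close>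

lemma lsc_on_attains_inf:
  assumes S: "compact S" "S \<noteq> {}" and w: "lsc_on S w"
  obtains x where "x \<in> S" "\<And>y. y \<in> S \<Longrightarrow> w x \<le> w y"
proof (rule ccontr)
  assume "\<not> thesis"
  with that have "\<forall>x\<in>S. \<exists>y\<in>S. w y < w x" by (meson not_le)
  then obtain h where h: "\<And>x. x \<in> S \<Longrightarrow> h x \<in> S \<and> w (h x) < w x" by metis
  have "\<forall>x\<in>S. \<exists>U. open U \<and> x \<in> U \<and> (\<forall>z\<in>U \<inter> S. w (h x) < w z)"
  proof
    fix x assume x: "x \<in> S"
    have "\<forall>\<^sub>F y in at x within S. w (h x) < w y"
      using w h[OF x] x unfolding lsc_on_def by blast
    then obtain U where "open U" "x \<in> U" "\<And>z. z \<in> U \<Longrightarrow> z \<noteq> x \<Longrightarrow> z \<in> S \<Longrightarrow> w (h x) < w z"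
      unfolding eventually_at_topological by blast
    then show "\<exists>U. open U \<and> x \<in> U \<and> (\<forall>z\<in>U \<inter> S. w (h x) < w z)"
      using h[OF x] by (metis IntE)
  qed
  from bchoice[OF this] obtain U where U: "\<forall>x\<in>S. open (U x) \<and> x \<in> U x \<and> (\<forall>z\<in>U x \<inter> S. w (h x) < w z)"
    by blast
  obtain F where F: "F \<subseteq> S" "finite F" "S \<subseteq> (\<Union>x\<in>F. U x)"
    using compactE_image[OF S(1), of S U] U by (metis UN_iff subsetI)
  have "F \<noteq> {}" using F S by auto
  then obtain x where x: "x \<in> F" "\<And>y. y \<in> F \<Longrightarrow> w (h x) \<le> w (h y)"
    using arg_min_if_finite[OF F(2), of "w \<circ> h"] by (metis comp_apply not_le)
  \<comment> \<open>The point \<open>h x\<close> itself lies in some \<open>U y\<close> of the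
    finite cover, so \<open>w (h y) < w (h x)\<close>, against the minimal choice of
    \<open>x\<close>.\<close>
  moreover obtain y where "y \<in> F" "h x \<in> U y"
    using F h x(1) by blast
  ultimately show False
    using U h F(1) by (meson IntI not_le subsetD)
qed

text \<open>The difference \<open>u - \<phi>\<close> attains its minimum on the compact closure. At
  an interior minimum \<open>\<phi>\<close> would be an admissible test function violating the
  viscosity inequality, so the minimum sits on the boundary, where the difference is
  nonnegative.\<close>

lemma comparison_smooth:
  fixes \<Omega> :: "(real^'n) set"
  assumes \<Omega>: "open \<Omega>" "bounded \<Omega>"
    and u: "dirichlet_supersolution k \<Omega> u"
    and cont: "continuous_on (closure \<Omega>) \<phi>"
    and smooth: "\<And>x. x \<in> \<Omega> \<Longrightarrow> C2_near \<phi> x"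
    and strict: "\<And>x. x \<in> \<Omega> \<Longrightarrow> - 1 < P_plus k (hessian \<phi> x)"
    and bdry: "\<And>x. x \<in> frontier \<Omega> \<Longrightarrow> \<phi> x \<le> 0"
    and x: "x \<in> \<Omega>"
  shows "\<phi> x \<le> u x"
proof -
  have "lsc_on (closure \<Omega>) (\<lambda>x. u x - \<phi> x)"
    using u cont by (simp add: dirichlet_supersolution_def lsc_on_diff_continuous)
  then obtain m where m: "m \<in> closure \<Omega>" "\<And>y. y \<in> closure \<Omega> \<Longrightarrow> u m - \<phi> m \<le> u y - \<phi> y"
    using lsc_on_attains_inf[of "closure \<Omega>" "\<lambda>x. u x - \<phi> x"] \<Omega> x by (auto simp: compact_closure)
  have "m \<notin> \<Omega>"
  proof
    assume "m \<in> \<Omega>"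
    then have "\<forall>\<^sub>F y in nhds m. u m - \<phi> m \<le> u y - \<phi> y"
      using \<Omega>(1) m(2) closure_subset unfolding eventually_nhds by blast
    then show False
      using u \<open>m \<in> \<Omega>\<close> smooth[OF \<open>m \<in> \<Omega>\<close>] strict[OF \<open>m \<in> \<Omega>\<close>]
      unfolding dirichlet_supersolution_def viscosity_supersolution_def local_min_at_def
      by (meson not_le)
  qed
  then have fr: "m \<in> frontier \<Omega>"
    using m(1) \<Omega>(1) by (simp add: frontier_def interior_open)
  then have "0 \<le> u m - \<phi> m"
    using u bdry[OF fr] by (fastforce simp: dirichlet_supersolution_def)
  also have "\<dots> \<le> u x - \<phi> x" using m(2) x closure_subset by blast
  finally show ?thesis by simp
qed

section \<open>Quadratic test functions and the value of the operator on their Hessians\<close>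

lemma quadratic_has_derivative:
  fixes B :: "real^'n \<Rightarrow> real^'n"
  assumes B: "linear B" "\<And>v w. v \<bullet> B w = B v \<bullet> w"
  shows "((\<lambda>x. C - (x - p) \<bullet> B (x - p)) has_derivative (\<lambda>h. - 2 * (B (x - p) \<bullet> h))) (at x)"
proof -
  interpret B: bounded_linear B using B(1) by (simp add: linear_conv_bounded_linear)
  have "((\<lambda>x. C - (x - p) \<bullet> B (x - p)) has_derivative
      (\<lambda>h. - ((x - p) \<bullet> B h + h \<bullet> B (x - p)))) (at x)"
    by (auto intro!: derivative_eq_intros B.has_derivative)
  \<comment> \<open>Self-adjointness of \<open>B\<close> merges the two terms of the product
    rule.\<close>
  moreover have "(x - p) \<bullet> B h + h \<bullet> B (x - p) = 2 * (B (x - p) \<bullet> h)" for h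
    by (simp only: B(2)[of "x - p" h] inner_commute[of h] mult_2)
  ultimately show ?thesis by simp
qed

lemma gradient_quadratic:
  fixes B :: "real^'n \<Rightarrow> real^'n"
  assumes "linear B" "\<And>v w. v \<bullet> B w = B v \<bullet> w"
  shows "gradient (\<lambda>x. C - (x - p) \<bullet> B (x - p)) = (\<lambda>x. - 2 *\<^sub>R B (x - p))"
  by (simp add: gradient_def fun_eq_iff vec_eq_iff inner_axis
      frechet_derivative_at[OF quadratic_has_derivative[OF assms], symmetric])

lemma gradient_quadratic_has_derivative:
  fixes B :: "real^'n \<Rightarrow> real^'n"
  assumes B: "linear B" "\<And>v w. v \<bullet> B w = B v \<bullet> w"
  shows "(gradient (\<lambda>x. C - (x - p) \<bullet> B (x - p)) has_derivative (\<lambda>h. - 2 *\<^sub>R B h)) (at x)"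
proof -
  interpret B: bounded_linear B using B(1) by (simp add: linear_conv_bounded_linear)
  show ?thesis
    unfolding gradient_quadratic[OF B]
    by (auto intro!: derivative_eq_intros B.has_derivative)
qed

lemma hessian_quadratic:
  fixes B :: "real^'n \<Rightarrow> real^'n"
  assumes "linear B" "\<And>v w. v \<bullet> B w = B v \<bullet> w"
  shows "hessian (\<lambda>x. C - (x - p) \<bullet> B (x - p)) x = matrix (\<lambda>h. - 2 *\<^sub>R B h)"
  by (simp only: hessian_def
      frechet_derivative_at[OF gradient_quadratic_has_derivative[OF assms], symmetric])

lemma C2_near_quadratic:
  fixes B :: "real^'n \<Rightarrow> real^'n"
  assumes "linear B" "\<And>v w. v \<bullet> B w = B v \<bullet> w"
  shows "C2_near (\<lambda>x. C - (x - p) \<bullet> B (x - p)) x"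
  unfolding C2_near_def
  using quadratic_has_derivative[OF assms] gradient_quadratic_has_derivative[OF assms]
  by (intro exI[of _ UNIV]) (simp add: differentiable_def hessian_quadratic[OF assms]; blast)

text \<open>The hypothesis on \<open>X\<close> says that \<open>f\<close> conjugates it to a
  diagonal matrix with entries \<open>a\<close> on \<open>I\<close> and \<open>b\<close> elsewhere.
  As \<open>b < a\<close>, the largest \<open>card I\<close> eigenvalues are all equal to
  \<open>a\<close>.\<close>

lemma P_plus_two_eigenvalues:
  fixes X :: "real^'n^'n" and f :: "real^'n \<Rightarrow> real^'n" and a b :: real
  assumes f: "orthogonal_transformation f"
    and X: "\<And>w. X *v f w = f (\<chi> i. (if i \<in> I then a else b) * w $ i)"
    and I: "I \<noteq> {}" "I \<noteq> UNIV" and ba: "b < a"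
  shows "P_plus (card I) X = card I * a"
proof -
  have lin: "linear f" and inj: "inj f" and surj: "surj f"
    using f orthogonal_transformation_linear orthogonal_transformation_inj
      orthogonal_transformation_surj by blast+
  have sp: "eigenspace X c = f ` {w. \<forall>i. (if i \<in> I then a else b) * w $ i = c * w $ i}" for c
  proof -
    have "f w \<in> eigenspace X c \<longleftrightarrow> (\<forall>i. (if i \<in> I then a else b) * w $ i = c * w $ i)" for w
      unfolding eigenspace_def mem_Collect_eq X linear_scale[OF lin, symmetric] inj_eq[OF inj]
      by (simp only: vec_eq_iff vec_lambda_beta vector_scaleR_component real_scaleR_def)
    then show ?thesis using surj by (auto simp: image_iff) (metis surjD)
  qed
  have dimf: "dim (f ` S) = dim S" for S
    using dim_image_eq[OF lin] inj inj_on_subset by blast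
  note dim_sub = dim_substandard_cart[where 'a = real, unfolded dim_vec_eq]
  have dim_a: "dim (eigenspace X a) = card I"
  proof -
    have "{w. \<forall>i. (if i \<in> I then a else b) * w $ i = a * w $ i} = {w. \<forall>i. i \<notin> I \<longrightarrow> w $ i = 0}"
      using ba by auto
    then show ?thesis unfolding sp dimf by (simp only: dim_sub)
  qed
  have dim_b: "dim (eigenspace X b) = card (- I)"
  proof -
    have "{w. \<forall>i. (if i \<in> I then a else b) * w $ i = b * w $ i} = {w. \<forall>i. i \<notin> - I \<longrightarrow> w $ i = 0}"
      using ba by auto
    then show ?thesis unfolding sp dimf by (simp only: dim_sub)
  qed
  have ev: "(\<exists>v. v \<noteq> 0 \<and> X *v v = c *\<^sub>R v) \<longleftrightarrow> c \<in> {b, a}" for c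
  proof
    assume "\<exists>v. v \<noteq> 0 \<and> X *v v = c *\<^sub>R v"
    then obtain v where v: "v \<noteq> 0" "v \<in> eigenspace X c" by (auto simp: eigenspace_def)
    then obtain w where w: "v = f w" "\<And>i. (if i \<in> I then a else b) * w $ i = c * w $ i"
      unfolding sp by blast
    then have "w \<noteq> 0" using v lin linear_0 by blast
    then obtain i where "w $ i \<noteq> 0" by (auto simp: vec_eq_iff)
    then show "c \<in> {b, a}" using w(2)[of i] by (auto split: if_splits)
  next
    assume "c \<in> {b, a}"
    moreover have "card I \<noteq> 0" "card (- I) \<noteq> 0" using I by (auto simp: card_eq_0_iff)
    ultimately have "dim (eigenspace X c) \<noteq> 0"
      using dim_a dim_b by (auto simp del: dim_eq_0)
    then show "\<exists>v. v \<noteq> 0 \<and> X *v v = c *\<^sub>R v"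
      unfolding dim_eq_0 eigenspace_def by auto
  qed
  have list: "ordered_eigenvalues X = replicate (card (- I)) b @ replicate (card I) a"
    using ba by (simp add: ordered_eigenvalues_def ev Collect_disj_eq dim_a dim_b insert_commute
        flip: insert_def)
  have N: "card (- I) + card I = CARD('n)"
    using card_Un_disjoint[of "- I" I] by (simp add: Compl_partition2)
  \<comment> \<open>Since \<open>eigval\<close> shifts its index by one, the list position is
    \<open>CARD('n) - i\<close>, which is at least \<open>card (- I)\<close> and hence in the block
    of \<open>a\<close>.\<close>
  have "eigval X (CARD('n) + 1 - i) = a" if "i \<in> {1..card I}" for i
    using that N by (auto simp: eigval_def list nth_append)
  then show ?thesis by (simp add: P_plus_def)
qed

text \<open>Comparison with a paraboloid centred at \<open>p\<close>, with curvature parameter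
  \<open>c\<close> along the disc and a much steeper \<open>M\<close> in the normal directions. The
  steepness confines its positivity set to a thin neighbourhood of the disc, and its value at
  \<open>p\<close> is the claimed bound.\<close>

lemma supersolution_ge_on_disc_centre:
  fixes \<Omega> :: "(real^'n) set" and f :: "real^'n \<Rightarrow> real^'n" and I :: "'n set"
  assumes \<Omega>: "open \<Omega>" "bounded \<Omega>" and u: "dirichlet_supersolution (card I) \<Omega> u"
    and f: "orthogonal_transformation f" and I: "I \<noteq> {}" "I \<noteq> UNIV"
    and \<rho>: "0 < \<rho>"
    and disc: "\<And>v. (\<forall>i. i \<notin> I \<longrightarrow> v $ i = 0) \<Longrightarrow> norm v \<le> \<rho> \<Longrightarrow> p + f v \<in> \<Omega>"
  shows "\<rho>\<^sup>2 / (4 * card I) \<le> u p"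
proof -
  \<comment> \<open>With this \<open>c\<close> the operator takes the value
    \<open>- 2 * c * card I = - 1/2\<close> on the paraboloid, strictly above
    \<open>- 1\<close>.\<close>
  define c where "c = 1 / (4 * real (card I))"
  have cardI: "card I > 0" using I by (simp add: card_gt_0_iff)
  then have c: "c > 0" by (simp add: c_def)
  have lin: "linear f" and inj: "inj f" and surj: "surj f"
    using f orthogonal_transformation_linear orthogonal_transformation_inj
      orthogonal_transformation_surj by blast+
  define V where "V = {v::real^'n. \<forall>i. i \<notin> I \<longrightarrow> v $ i = 0}"
  have "closed V"
    unfolding V_def by (intro closed_Collect_all closed_Collect_imp closed_Collect_eq open_Collect_const
        continuous_intros)
  then have "compact (V \<inter> cball 0 \<rho>)" by (simp add: closed_Int_compact)
  then have "compact ((\<lambda>v. p + f v) ` (V \<inter> cball 0 \<rho>))"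
    by (intro compact_continuous_image continuous_intros linear_continuous_on)
      (use lin in \<open>auto simp: linear_conv_bounded_linear\<close>)
  moreover have "(\<lambda>v. p + f v) ` (V \<inter> cball 0 \<rho>) \<subseteq> \<Omega>"
    using disc by (auto simp: V_def)
  ultimately obtain \<eta> where \<eta>: "\<eta> > 0" "(\<Union>x\<in>(\<lambda>v. p + f v) ` (V \<inter> cball 0 \<rho>). ball x \<eta>) \<subseteq> \<Omega>"
    using compact_subset_open_imp_ball_epsilon_subset \<Omega>(1) by metis
  \<comment> \<open>Chosen so that \<open>M * \<eta>\<^sup>2\<close> exceeds
    \<open>c * \<rho>\<^sup>2\<close>: at normal distance \<open>\<eta>\<close> or more from the
    plane of the disc the paraboloid is negative.\<close>
  define M where "M = c + c * \<rho>\<^sup>2 / \<eta>\<^sup>2"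
  have cM: "c < M" and M\<eta>: "c * \<rho>\<^sup>2 \<le> M * \<eta>\<^sup>2"
    using c \<rho> \<eta>(1) by (auto simp: M_def field_simps)
  define d where "d i = (if i \<in> I then c else M)" for i
  define D :: "real^'n \<Rightarrow> real^'n" where "D w = (\<chi> i. d i * w $ i)" for w
  \<comment> \<open>The diagonal map \<open>D\<close> is transported by \<open>f\<close> to the
    directions of the disc; conjugation by an orthogonal map keeps it self-adjoint.\<close>
  define B where "B = (\<lambda>x. f (D (inv f x)))"
  have finv: "f (inv f x) = x" "inv f (f x) = x" for x
    using inj surj by (simp_all add: surj_f_inv_f)
  have linB: "linear B"
    unfolding B_def
  proof (intro linearI)
    have li: "linear (inv f)"
      using f orthogonal_transformation_inv orthogonal_transformation_linear by blast
    have "D (v + w) = D v + D w" "D (r *\<^sub>R v) = r *\<^sub>R D v" for v w r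
      by (simp_all add: D_def vec_eq_iff algebra_simps)
    then show "f (D (inv f (v + w))) = f (D (inv f v)) + f (D (inv f w))"
      "f (D (inv f (r *\<^sub>R v))) = r *\<^sub>R f (D (inv f v))" for v w r
      by (simp_all add: linear_add[OF li] linear_add[OF lin] linear_scale[OF li] linear_scale[OF lin])
  qed
  have inner_f: "f v \<bullet> f w = v \<bullet> w" for v w
    using f by (simp add: orthogonal_transformation_def)
  have selfadj: "v \<bullet> B w = B v \<bullet> w" for v w
  proof -
    have "v \<bullet> B w = inv f v \<bullet> D (inv f w)"
      by (metis B_def finv(1) inner_f)
    also have "\<dots> = D (inv f v) \<bullet> inv f w"
      by (simp add: D_def inner_vec_def algebra_simps)
    also have "\<dots> = B v \<bullet> w"
      by (metis B_def finv(1) inner_f)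
    finally show ?thesis .
  qed
  define \<phi> where "\<phi> = (\<lambda>x. c * \<rho>\<^sup>2 - (x - p) \<bullet> B (x - p))"
  have hess: "P_plus (card I) (hessian \<phi> x) = card I * (- 2 * c)" for x
  proof (rule P_plus_two_eigenvalues[where f = f and b = "- 2 * M"])
    show "orthogonal_transformation f" "I \<noteq> {}" "I \<noteq> UNIV" "- 2 * M < - 2 * c"
      using f I cM by simp_all
    have "linear (\<lambda>h. - 2 *\<^sub>R B h)"
      using linB by (intro linear_compose_scale_right)
    then have "hessian \<phi> x *v v = - 2 *\<^sub>R B v" for v
      unfolding \<phi>_def hessian_quadratic[OF linB selfadj] by (simp only: fun_cong[OF matrix_vector_mul(2)])
    then have "hessian \<phi> x *v f w = - 2 *\<^sub>R f (D w)" for w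
      by (simp only: B_def finv)
    also have "- 2 *\<^sub>R f (D w) = f (- 2 *\<^sub>R D w)" for w
      by (simp only: linear_scale[OF lin])
    also have "- 2 *\<^sub>R D w = (\<chi> i. (if i \<in> I then - 2 * c else - 2 * M) * w $ i)" for w
      by (simp add: D_def d_def vec_eq_iff)
    finally show "hessian \<phi> x *v f w = f (\<chi> i. (if i \<in> I then - 2 * c else - 2 * M) * w $ i)" for w .
  qed
  \<comment> \<open>In the rotated coordinates \<open>y\<close> is the part of \<open>x - p\<close>
    along the disc and \<open>z\<close> the normal part. Positivity of \<open>\<phi>\<close> forces
    \<open>norm y < \<rho>\<close> and \<open>norm z < \<eta>\<close>, so \<open>x\<close> is within
    \<open>\<eta>\<close> of the disc point \<open>p + f y\<close>. As the open set
    \<open>\<Omega>\<close> misses its frontier, this yields the boundary condition for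
    \<open>\<phi>\<close>.\<close>
  have pos: "x \<in> \<Omega>" if "0 < \<phi> x" for x
  proof -
    define w where "w = inv f (x - p)"
    define y :: "real^'n" where "y = (\<chi> i. if i \<in> I then w $ i else 0)"
    define z where "z = w - y"
    have x: "x = p + f w" by (simp add: w_def finv)
    have "(x - p) \<bullet> B (x - p) = w \<bullet> D w"
      by (simp add: x B_def finv inner_f)
    also have "\<dots> = c * (y \<bullet> y) + M * (z \<bullet> z)"
      by (auto simp: inner_vec_def D_def d_def y_def z_def sum_distrib_left sum.distrib[symmetric]
          intro!: sum.cong)
    finally have "c * (norm y)\<^sup>2 + M * (norm z)\<^sup>2 < c * \<rho>\<^sup>2"
      using that by (simp add: \<phi>_def power2_norm_eq_inner)
    moreover have "0 \<le> c * (norm y)\<^sup>2" "0 \<le> M * (norm z)\<^sup>2"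
      using c cM by auto
    ultimately have "c * (norm y)\<^sup>2 < c * \<rho>\<^sup>2" "M * (norm z)\<^sup>2 < M * \<eta>\<^sup>2"
      using M\<eta> by linarith+
    then have "norm y < \<rho>" "norm z < \<eta>"
      using c cM \<rho> \<eta>(1) by (auto intro: power2_less_imp_less)
    moreover have "dist (p + f y) x = norm z"
      using orthogonal_transformation_norm[OF f, of z]
      by (simp add: x z_def dist_norm linear_diff[OF lin] norm_minus_commute)
    moreover have "y \<in> V" by (simp add: V_def y_def)
    ultimately show ?thesis using \<eta>(2) by fastforce
  qed
  have "\<phi> p \<le> u p"
  proof (rule comparison_smooth[OF \<Omega> u])
    show "continuous_on (closure \<Omega>) \<phi>"
      unfolding \<phi>_def using has_derivative_continuous[OF quadratic_has_derivative[OF linB selfadj]]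
      by (intro continuous_at_imp_continuous_on) blast
    show "C2_near \<phi> x" for x unfolding \<phi>_def by (rule C2_near_quadratic[OF linB selfadj])
    show "- 1 < P_plus (card I) (hessian \<phi> x)" for x
      unfolding hess using cardI by (simp add: c_def)
    show "\<phi> x \<le> 0" if "x \<in> frontier \<Omega>" for x
      using pos[of x] that \<Omega>(1) by (auto simp: frontier_def interior_open not_less[symmetric])
    show "p \<in> \<Omega>" using disc[of 0] \<rho> by (simp add: linear_0[OF lin])
  qed
  then show ?thesis by (simp add: \<phi>_def c_def)
qed

section \<open>Discs approaching the flat piece of the boundary\<close>

theorem proposition3:
  fixes \<Omega> :: "(real^'n) set" and e :: "nat \<Rightarrow> 'n" and k :: nat and \<delta> :: real
    and T :: "real^'n \<Rightarrow> real^'n"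
  assumes "1 \<le> k" and "k < CARD('n)"
    and "bij_betw e {1..CARD('n)} UNIV"
    and "open \<Omega>" and "\<Omega> \<noteq> {}" and "bounded \<Omega>" and "convex \<Omega>"
    and "rigid_motion T" and "\<delta> > 0" and "T ` flat_ball e k \<delta> \<subseteq> frontier \<Omega>"
  shows "\<not> (\<exists>u. dirichlet_supersolution k \<Omega> u \<and> (u \<longlongrightarrow> 0) (at (T 0) within \<Omega>))"
proof
  assume "\<exists>u. dirichlet_supersolution k \<Omega> u \<and> (u \<longlongrightarrow> 0) (at (T 0) within \<Omega>)"
  then obtain u where u: "dirichlet_supersolution k \<Omega> u"
    and lim: "(u \<longlongrightarrow> 0) (at (T 0) within \<Omega>)" by blast
  obtain a f where f: "orthogonal_transformation f" and T: "T = (\<lambda>x. a + f x)"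
    using \<open>rigid_motion T\<close> unfolding rigid_motion_def by blast
  have lin: "linear f" using f orthogonal_transformation_linear by blast
  obtain q where q: "q \<in> \<Omega>" using \<open>\<Omega> \<noteq> {}\<close> by blast
  define I where "I = e ` {1..k}"
  have inj: "inj_on e {1..CARD('n)}" and eUNIV: "e ` {1..CARD('n)} = UNIV"
    using assms(3) by (auto simp: bij_betw_def)
  have cardI: "card I = k"
    unfolding I_def using inj_on_subset[OF inj, of "{1..k}"] \<open>k < CARD('n)\<close> by (simp add: card_image)
  have I: "I \<noteq> {}" "I \<noteq> UNIV"
    using cardI assms(1,2) by auto
  have flat: "v \<in> flat_ball e k \<delta>" if "\<forall>i. i \<notin> I \<longrightarrow> v $ i = 0" "norm v < \<delta>" for v
  proof -
    have "e i \<notin> I" if "i \<in> {k+1..CARD('n)}" for i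
      using that inj assms(2) by (auto simp: I_def dest!: inj_onD)
    then show ?thesis using that by (simp add: flat_ball_def)
  qed
  \<comment> \<open>The disc centres run along the segment from \<open>a = T 0\<close> to the
    interior point \<open>q\<close>.\<close>
  define p where "p t = a + t *\<^sub>R (q - a)" for t
  have inside: "p t + f v \<in> \<Omega>"
    if t: "t \<in> {0<..1/2}" and v: "\<forall>i. i \<notin> I \<longrightarrow> v $ i = 0" "norm v \<le> \<delta>/4" for t v
  proof -
    \<comment> \<open>The homothety with centre \<open>q\<close> and ratio \<open>1 - t\<close>
      sends \<open>T v'\<close> to \<open>p t + f v\<close>. For \<open>t \<le> 1/2\<close>, a
      radius of \<open>\<delta>/4\<close> keeps \<open>norm v'\<close> at most
      \<open>\<delta>/2\<close>, inside the flat ball, so one radius serves for all these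
      \<open>t\<close>.\<close>
    define v' where "v' = (1 / (1 - t)) *\<^sub>R v"
    have "norm v' = norm v / (1 - t)" using t by (simp add: v'_def)
    also have "\<dots> \<le> (\<delta>/4) / (1/2)"
      using t v(2) \<open>\<delta> > 0\<close> by (intro frac_le) auto
    also have "\<dots> < \<delta>" using \<open>\<delta> > 0\<close> by simp
    finally have "T v' \<in> frontier \<Omega>"
      using assms(10) flat[of v'] v(1) by (auto simp: v'_def)
    then have "T v' \<in> closure \<Omega>" by (simp add: frontier_def)
    then have "T v' - t *\<^sub>R (T v' - q) \<in> interior \<Omega>"
      using mem_interior_closure_convex_shrink[OF \<open>convex \<Omega>\<close>, of q "T v'" t] q t \<open>open \<Omega>\<close>
      by (simp add: interior_open)
    moreover have "f v = (1 - t) *\<^sub>R f v'"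
      using t by (simp add: v'_def linear_scale[OF lin])
    then have "T v' - t *\<^sub>R (T v' - q) = p t + f v"
      by (simp add: T p_def algebra_simps)
    ultimately show ?thesis using interior_subset by auto
  qed
  have low: "(\<delta>/4)\<^sup>2 / (4 * k) \<le> u (p t)" if "t \<in> {0<..1/2}" for t
    using supersolution_ge_on_disc_centre[of \<Omega> I u f "\<delta>/4" "p t"] u f I assms(4,6,9)
      inside[OF that] by (simp add: cardI)
  have ev: "\<forall>\<^sub>F t in at_right 0. t \<in> {0<..1/2::real}"
    by (rule eventually_at_rightI[of 0 "1/2"]) auto
  have "T 0 = a" by (simp add: T linear_0[OF lin])
  moreover have "T 0 \<in> frontier \<Omega>" using assms(10) flat[of 0] \<open>\<delta> > 0\<close> by auto
  \<comment> \<open>This guarantees \<open>p t \<noteq> a\<close>, as the punctured filter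
    \<open>at a within \<Omega>\<close> demands.\<close>
  ultimately have "a \<notin> \<Omega>" using \<open>open \<Omega>\<close> by (simp add: frontier_def interior_open)
  have "p t \<in> \<Omega>" if "t \<in> {0<..1/2}" for t
    using inside[OF that, of 0] \<open>\<delta> > 0\<close> by (simp add: linear_0[OF lin])
  then have "\<forall>\<^sub>F t in at_right 0. p t \<in> \<Omega> \<and> p t \<noteq> a"
    using \<open>a \<notin> \<Omega>\<close> ev by (auto elim!: eventually_mono)
  moreover have "(p \<longlongrightarrow> a) (at_right 0)"
    unfolding p_def by (auto intro!: tendsto_eq_intros)
  ultimately have "filterlim p (at a within \<Omega>) (at_right 0)"
    by (auto simp: filterlim_at)
  with lim have "((\<lambda>t. u (p t)) \<longlongrightarrow> 0) (at_right 0)"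
    unfolding \<open>T 0 = a\<close> by (rule filterlim_compose)
  \<comment> \<open>The lower bound does not depend on \<open>t\<close>, so it survives in the limit
    and contradicts the limit being zero.\<close>
  then have "(\<delta>/4)\<^sup>2 / (4 * k) \<le> 0"
    using low ev by (intro tendsto_lowerbound) (auto elim!: eventually_mono)
  moreover have "(\<delta>/4)\<^sup>2 / (4 * k) > 0" using assms(1,9) by simp
  ultimately show False by simp
qed

end
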